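(* Let $f,h,g:\mathbb{R}\to\mathbb{R}$ be real functions and define $$K(x,y)=f(x+y)-h(x-y),\quad x,y\in\mathbb{R}.$$ The triple $(f,h,g)$ is a measurable solution of Abel's functional equation $$f(x+y)=h(x-y)+g(xy)\quad\text{for all } x,y\in\mathbb{R}$$ if and only if the following three conditions hold: (i) $(K(W_t,y),t\ge 0)\in\mathcal{M}$ for any $y\in\mathbb{R}$; (ii) $(K(x,W_t),t\ge 0)\in\mathcal{M}$ for any $x\in\mathbb{R}$; (iii) $K(0,y)=K(x,0)=\lambda$ for all $x,y\in\mathbb{R}$, where $\lambda$ is some constant.
   Context: A triple $(f,h,g)$ is a measurable solution if $f,h,g$ are Lebesgue measurable and satisfy the equation. $W=(W_t,t\ge 0)$ is a standard Brownian motion (so $W_0=0$) on a complete probability space $(\Omega,\mathcal{F},P)$. $(\mathcal{F}_t)_{t\ge 0}$ is a filtration satisfying the usual conditions of right-continuity and completeness, containing the filtration generated by $W$, such that $W_t-W_s$ is independent of $\mathcal{F}_s$ whenever $0\le s\le t$ (so $W$ is a Brownian motion with respect to $(\mathcal{F}_t)$), and large enough to support an additional Brownian motion $B$ independent of $W$. $\mathcal{M}$ denotes the class of martingales adapted to $(\mathcal{F}_t)$ with $P$-almost surely right-continuous paths.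
   Formalization: Since (i)–(iii) do not involve g, the equivalence is false for a fixed g (f = h = 0, g = 1); it is stated as: (i)–(iii) hold if and only if there is some g for which (f,h,g) is a measurable solution. *)

theory Defs
  imports "HOL-Probability.Probability"
begin

text \<open>
  Stochastic processes are functions \<open>X :: real \<Rightarrow> 'a \<Rightarrow> real\<close> and filtrations are functions
  \<open>F :: real \<Rightarrow> 'a measure\<close>. Only times \<open>t \<ge> 0\<close> matter; nothing is required at negative
  times. Of \<open>F t\<close> only the sigma-algebra is used, never the measure it carries.
\<close>

definition adapted :: "(real \<Rightarrow> 'a measure) \<Rightarrow> (real \<Rightarrow> 'a \<Rightarrow> real) \<Rightarrow> bool" where
  "adapted F X \<longleftrightarrow> (\<forall>t\<ge>0. X t \<in> borel_measurable (F t))"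

definition martingale :: "'a measure \<Rightarrow> (real \<Rightarrow> 'a measure) \<Rightarrow> (real \<Rightarrow> 'a \<Rightarrow> real) \<Rightarrow> bool" where
  "martingale M F X \<longleftrightarrow>
     adapted F X \<and>
     (\<forall>t\<ge>0. integrable M (X t)) \<and>
     (\<forall>s t. 0 \<le> s \<and> s \<le> t \<longrightarrow> (AE \<omega> in M. real_cond_exp M (F s) (X t) \<omega> = X s \<omega>))"

definition rc_martingales :: "'a measure \<Rightarrow> (real \<Rightarrow> 'a measure) \<Rightarrow> (real \<Rightarrow> 'a \<Rightarrow> real) set" where
  "rc_martingales M F =
     {X. martingale M F X \<and> (AE \<omega> in M. \<forall>t\<ge>0. continuous (at_right t) (\<lambda>u. X u \<omega>))}"

definition standard_BM :: "'a measure \<Rightarrow> (real \<Rightarrow> 'a \<Rightarrow> real) \<Rightarrow> bool" where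
  "standard_BM M X \<longleftrightarrow>
     prob_space M \<and>
     (\<forall>t\<ge>0. X t \<in> borel_measurable M) \<and>
     (AE \<omega> in M. X 0 \<omega> = 0) \<and>
     (\<forall>(n::nat) \<tau>. 0 \<le> \<tau> 0 \<and> (\<forall>i<n. \<tau> i \<le> \<tau> (Suc i)) \<longrightarrow>
        prob_space.indep_vars M (\<lambda>_. borel) (\<lambda>i \<omega>. X (\<tau> (Suc i)) \<omega> - X (\<tau> i) \<omega>) {..<n}) \<and>
     (\<forall>s t. 0 \<le> s \<and> s < t \<longrightarrow>
        distributed M lborel (\<lambda>\<omega>. X t \<omega> - X s \<omega>) (normal_density 0 (sqrt (t - s)))) \<and>
     (AE \<omega> in M. continuous_on {0..} (\<lambda>t. X t \<omega>))"

definition usual_filtration :: "'a measure \<Rightarrow> (real \<Rightarrow> 'a measure) \<Rightarrow> bool" where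
  "usual_filtration M F \<longleftrightarrow>
     (\<forall>t\<ge>0. subalgebra M (F t)) \<and>
     (\<forall>s t. 0 \<le> s \<and> s \<le> t \<longrightarrow> sets (F s) \<subseteq> sets (F t)) \<and>
     (\<forall>t\<ge>0. sets (F t) = (\<Inter>u\<in>{t<..}. sets (F u))) \<and>
     null_sets M \<subseteq> sets (F 0)"

definition indep_processes ::
    "'a measure \<Rightarrow> (real \<Rightarrow> 'a \<Rightarrow> real) \<Rightarrow> (real \<Rightarrow> 'a \<Rightarrow> real) \<Rightarrow> bool" where
  "indep_processes M X Y \<longleftrightarrow>
     prob_space.indep_var M
       (PiM {0..} (\<lambda>_. borel)) (\<lambda>\<omega>. \<lambda>t\<in>{0..}. X t \<omega>)
       (PiM {0..} (\<lambda>_. borel)) (\<lambda>\<omega>. \<lambda>t\<in>{0..}. Y t \<omega>)"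

text \<open>
  Adaptedness of \<open>W\<close> says exactly that \<open>F\<close> contains the filtration generated by \<open>W\<close>. The sets
  \<open>{\<omega> \<in> space M. W t \<omega> - W s \<omega> \<in> A}\<close> with \<open>A\<close> Borel form the sigma-algebra generated by the increment.
\<close>

locale brownian_setting = prob_space M + complete_measure M
  for M :: "'a measure" +
  fixes F :: "real \<Rightarrow> 'a measure"
    and W :: "real \<Rightarrow> 'a \<Rightarrow> real"
  assumes usual_filtration: "usual_filtration M F"
    and W_standard_BM: "standard_BM M W"
    and W_adapted: "adapted F W"
    and W_increments_indep: "\<And>s t. 0 \<le> s \<Longrightarrow> s \<le> t \<Longrightarrow>
          indep_set {{\<omega> \<in> space M. W t \<omega> - W s \<omega> \<in> A} | A. A \<in> sets borel} (sets (F s))"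
    and additional_BM: "\<exists>B. standard_BM M B \<and> adapted F B \<and> indep_processes M W B"

definition measurable_abel_solution ::
    "(real \<Rightarrow> real) \<Rightarrow> (real \<Rightarrow> real) \<Rightarrow> (real \<Rightarrow> real) \<Rightarrow> bool" where
  "measurable_abel_solution f h g \<longleftrightarrow>
     f \<in> borel_measurable lebesgue \<and>
     h \<in> borel_measurable lebesgue \<and>
     g \<in> borel_measurable lebesgue \<and>
     (\<forall>x y. f (x + y) = h (x - y) + g (x * y))"

text \<open>
  The function \<open>g\<close> does not enter the kernel below, so conditions on the kernel can only
  characterise those \<open>f\<close>, \<open>h\<close> for which some \<open>g\<close> completes the triple to a solution
  (then \<open>g u = abel_kernel f h u 1\<close>).
\<close>

definition abel_kernel :: "(real \<Rightarrow> real) \<Rightarrow> (real \<Rightarrow> real) \<Rightarrow> real \<Rightarrow> real \<Rightarrow> real" where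
  "abel_kernel f h x y = f (x + y) - h (x - y)"

end

theory Submission
  imports Defs "HOL-Real_Asymp.Real_Asymp"
begin

text \<open>
  Both sides of the equivalence say that the kernel has the form \<open>K x y = c + a * (x * y)\<close>.

  For a measurable solution, \<open>K x y = g (x * y)\<close>. Putting \<open>y = x\<close>, \<open>y = - x\<close> and \<open>y = 0\<close> into Abel's
  equation expresses \<open>h\<close> through \<open>G u = g u - g 0\<close> by \<open>h z - h 0 = G (z\<^sup>2 / 4)\<close> and shows that \<open>G\<close> is odd.
  The equation itself then becomes the additivity of \<open>G\<close>, because
  \<open>(x + y)\<^sup>2 / 4 = (x - y)\<^sup>2 / 4 + x * y\<close>. A Lebesgue measurable additive function is linear
  (\<open>additive_lebesgue_measurable_imp_linear\<close>), so that \<open>K\<close> along the Brownian motion is an affine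
  function of \<open>W\<close>, and hence a continuous martingale.

  For the converse, the point is that a function \<open>k\<close> for which \<open>k (W t)\<close> is a martingale with almost
  surely right-continuous paths must be affine (\<open>rc_martingale_imp_affine\<close>). Such a \<open>k\<close> inherits its
  regularity from the paths: while a Brownian path crosses the level \<open>x\<close>
  downwards, it runs continuously through all levels just below \<open>x\<close> right after its last visit to
  \<open>x\<close>, so right-continuity of \<open>k (W t)\<close> in time is left-continuity of \<open>k\<close> at \<open>x\<close>; an upward crossing
  gives right-continuity. Both crossings have positive probability
  (\<open>right_continuous_along_W_imp_continuous\<close>). Next, the martingale property between the times
  \<open>1\<close> and \<open>1 + t\<close> says that \<open>k z\<close> is the mean of \<open>k\<close> under the normal distribution with mean \<open>z\<close> and
  variance \<open>t\<close>, first for almost all \<open>z\<close> and by continuity for all \<open>z\<close>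
  (\<open>continuous_martingale_imp_gaussian_mean_value\<close>). A maximum principle then shows that \<open>k\<close> lies
  neither above nor below any of its chords (\<open>gaussian_mean_value_imp_affine\<close>).

  Applied to both variables of the kernel, this makes \<open>K\<close> affine in each of them; as \<open>K\<close> is constant
  on the axes, it is \<open>c + a * (x * y)\<close>. This forces \<open>h\<close> and \<open>f\<close> to be quadratic polynomials.
\<close>

section \<open>Measurable additive functions\<close>

text \<open>
  On a large part of \<open>{0..1}\<close> the function is bounded by some \<open>n\<close>. That part meets each of its small
  translates, so every small \<open>z\<close> is a difference of two of its points and \<open>G\<close> is bounded near \<open>0\<close>.
  Subtracting \<open>G 1 * z\<close> makes \<open>G\<close> periodic, hence bounded everywhere, and a bounded additive function
  vanishes.
\<close>
lemma additive_lebesgue_measurable_imp_linear: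
  fixes G :: "real \<Rightarrow> real"
  assumes add: "\<And>x y. G (x + y) = G x + G y"
    and meas: "G \<in> borel_measurable lebesgue"
  shows "G x = G 1 * x"
proof -
  have zero: "G 0 = 0" using add[of 0 0] by simp
  have minus: "G (- z) = - G z" for z using add[of z "- z"] zero by simp
  have mult_nat: "G (real n * z) = real n * G z" for n z
    by (induction n) (simp_all add: zero add distrib_right)
  have mult_int: "G (of_int k * z) = of_int k * G z" for k z
  proof (cases "k \<ge> 0")
    case True then show ?thesis using mult_nat[of "nat k" z] by simp
  next
    case False then show ?thesis using mult_nat[of "nat (- k)" z] minus[of "of_int k * z"] by simp
  qed
  obtain C where C: "\<And>z. \<bar>z\<bar> < 1/3 \<Longrightarrow> \<bar>G z\<bar> \<le> C"
  proof -
    define A where "A n = {z \<in> {0..1}. \<bar>G z\<bar> \<le> real n}" for n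
    have A_sets [measurable]: "A n \<in> sets lebesgue" for n
    proof -
      have "{z \<in> space lebesgue. \<bar>G z\<bar> \<le> real n} \<in> sets lebesgue"
        using meas by (intro borel_measurable_le borel_measurable_abs) auto
      then have "{0..1} \<inter> {z \<in> space lebesgue. \<bar>G z\<bar> \<le> real n} \<in> sets lebesgue"
        by (intro sets.Int) auto
      then show ?thesis by (auto simp: A_def Int_def)
    qed
    have un: "(\<Union>n. A n) = {0..1}"
      by (auto simp: A_def real_arch_simple)
    have "incseq A" by (rule incseq_SucI) (auto simp: A_def)
    moreover have lm: "A n \<in> lmeasurable" for n
      by (rule fmeasurableI2[OF _ _ A_sets, of "{0..1}"]) (auto simp: A_def)
    ultimately have "(\<lambda>n. measure lebesgue (A n)) \<longlonglongrightarrow> measure lebesgue (\<Union>n. A n)"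
      by (intro Lim_measure_incseq) (auto simp: un)
    then have "(\<lambda>n. measure lebesgue (A n)) \<longlonglongrightarrow> 1" by (simp add: un)
    then have "eventually (\<lambda>n. measure lebesgue (A n) > 2/3) sequentially"
      by (rule order_tendstoD) simp
    then obtain n where n: "measure lebesgue (A n) > 2/3"
      by (auto simp: eventually_sequentially)
    have "\<bar>G z\<bar> \<le> 2 * real n" if z: "\<bar>z\<bar> < 1/3" for z
    proof -
      let ?B = "(+) z ` A n"
      have B: "?B \<in> lmeasurable" "measure lebesgue ?B = measure lebesgue (A n)"
        using lm by (auto simp: measurable_translation measure_translation)
      \<comment> \<open>Two disjoint sets of measure above \<open>2/3\<close> do not fit into an interval shorter than \<open>4/3\<close>.\<close>
      have "A n \<inter> ?B \<noteq> {}"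
      proof
        assume "A n \<inter> ?B = {}"
        then have "measure lebesgue (A n \<union> ?B) = measure lebesgue (A n) + measure lebesgue ?B"
          using lm B by (intro measure_Un_AE) auto
        moreover have "A n \<union> ?B \<subseteq> {min 0 z..max 1 (1 + z)}" by (auto simp: A_def)
        then have "measure lebesgue (A n \<union> ?B) \<le> measure lebesgue {min 0 z..max 1 (1 + z)}"
          using lm B by (intro measure_mono_fmeasurable) auto
        moreover have "measure lebesgue {min 0 z..max 1 (1 + z)} = 1 + \<bar>z\<bar>"
          by (simp add: min_def max_def)
        ultimately show False using n B z by simp
      qed
      then obtain b where "b \<in> A n" "z + b \<in> A n" by auto
      moreover have "G z = G (z + b) - G b" by (simp add: add)
      ultimately show ?thesis by (auto simp: A_def)
    qed
    then show ?thesis by (rule that)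
  qed
  define L where "L z = G z - G 1 * z" for z
  define D where "D = 4 * (C + \<bar>G 1\<bar>)"
  have L_bdd: "\<bar>L z\<bar> \<le> D" for z
  proof -
    \<comment> \<open>Periodicity reduces the argument to \<open>{0..<1}\<close>, and division by \<open>4\<close> moves it into the interval
      where \<open>C\<close> is a bound.\<close>
    have "G z = G 1 * of_int \<lfloor>z\<rfloor> + 4 * G (frac z / 4)"
      using mult_int[of 4 "frac z / 4"] mult_int[of "\<lfloor>z\<rfloor>" 1] add[of "of_int \<lfloor>z\<rfloor>" "frac z"]
      by (simp add: mult.commute) (simp add: frac_def)
    then have L4: "L z = 4 * L (frac z / 4)" by (simp add: L_def frac_def field_simps)
    have q: "\<bar>frac z / 4\<bar> < 1/3" using frac_lt_1[of z] frac_ge_0[of z] by simp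
    have "\<bar>L (frac z / 4)\<bar> \<le> \<bar>G (frac z / 4)\<bar> + \<bar>G 1\<bar> * \<bar>frac z / 4\<bar>"
      unfolding L_def abs_mult[symmetric] by simp
    also have "\<bar>G 1\<bar> * \<bar>frac z / 4\<bar> \<le> \<bar>G 1\<bar> * 1" using q by (intro mult_left_mono) auto
    finally have "\<bar>L (frac z / 4)\<bar> \<le> C + \<bar>G 1\<bar>" using C[OF q] by simp
    then show ?thesis by (simp add: D_def L4)
  qed
  have L0: "L x = 0"
  proof (rule ccontr)
    assume "L x \<noteq> 0"
    then obtain n where "D < real n * \<bar>L x\<bar>" using reals_Archimedean3[of "\<bar>L x\<bar>"] by auto
    moreover have "real n * L x = L (real n * x)" using mult_nat[of n x] by (simp add: L_def right_diff_distrib)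
    then have "real n * \<bar>L x\<bar> = \<bar>L (real n * x)\<bar>" by (metis abs_mult abs_of_nat)
    ultimately show False using L_bdd[of "real n * x"] by simp
  qed
  then show ?thesis by (simp add: L_def)
qed

section \<open>Continuity along a crossing path\<close>

text \<open>
  After the last visit \<open>\<tau>\<close> of the path to the level \<open>x\<close> all values are below \<open>x\<close>, and by the
  intermediate value theorem all levels slightly below \<open>x\<close> are taken at times slightly after \<open>\<tau>\<close>.
\<close>
lemma downward_path_imp_left_continuous:
  fixes w k :: "real \<Rightarrow> real"
  assumes "a \<le> b" and w: "continuous_on {a..b} w" and x: "w b < x" "x \<le> w a"
    and rc: "\<And>t. t \<in> {a..b} \<Longrightarrow> continuous (at_right t) (\<lambda>u. k (w u))"
  shows "continuous (at_left x) k"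
proof -
  define T where "T = {t \<in> {a..b}. w t = x}"
  have "compact T"
    using continuous_closed_preimage_constant[OF w, of x]
    by (auto simp: T_def compact_eq_bounded_closed intro: bounded_subset[of "{a..b}"])
  moreover have "T \<noteq> {}"
    using IVT2'[of w b x a] assms by (auto simp: T_def)
  ultimately obtain \<tau> where \<tau>: "\<tau> \<in> T" "\<And>t. t \<in> T \<Longrightarrow> t \<le> \<tau>"
    using compact_attains_sup by metis
  have \<tau>b: "a \<le> \<tau>" "\<tau> < b" "w \<tau> = x" using \<tau>(1) x by (auto simp: T_def less_le)
  have below: "w t < x" if t: "t \<in> {\<tau><..b}" for t
  proof (rule ccontr)
    assume "\<not> w t < x"
    then obtain s where "t \<le> s" "s \<le> b" "w s = x"
      using IVT2'[of w b x t] x t \<tau>b continuous_on_subset[OF w, of "{t..b}"] by auto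
    then show False using \<tau>(2)[of s] t \<tau>b by (auto simp: T_def)
  qed
  have "((\<lambda>u. k (w u)) \<longlongrightarrow> k x) (at_right \<tau>)"
    using rc[of \<tau>] \<tau>b by (simp add: continuous_within)
  then have "eventually (\<lambda>y. dist (k y) (k x) < e) (at_left x)" if "e > 0" for e
  proof -
    assume "((\<lambda>u. k (w u)) \<longlongrightarrow> k x) (at_right \<tau>)"
    from tendstoD[OF this \<open>e > 0\<close>] obtain d where d: "d > \<tau>"
      "\<And>u. \<tau> < u \<Longrightarrow> u < d \<Longrightarrow> dist (k (w u)) (k x) < e"
      unfolding eventually_at_right_field by blast
    obtain u where u: "\<tau> < u" "u < d" "u < b"
      using dense[of \<tau> "min d b"] d(1) \<tau>b by auto
    have "dist (k y) (k x) < e" if y: "w u < y" "y < x" for y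
    proof -
      obtain s where s: "\<tau> \<le> s" "s \<le> u" "w s = y"
        using IVT2'[of w u y \<tau>] y u \<tau>b continuous_on_subset[OF w, of "{\<tau>..u}"] by auto
      then have "s \<noteq> \<tau>" using y \<tau>b by auto
      then show ?thesis using d(2)[of s] s u by auto
    qed
    then show ?thesis
      unfolding eventually_at_left_field using below[of u] u by auto
  qed
  then show ?thesis by (simp add: continuous_within tendsto_iff)
qed

lemma upward_path_imp_right_continuous:
  fixes w k :: "real \<Rightarrow> real"
  assumes "a \<le> b" and w: "continuous_on {a..b} w" and x: "w a \<le> x" "x < w b"
    and rc: "\<And>t. t \<in> {a..b} \<Longrightarrow> continuous (at_right t) (\<lambda>u. k (w u))"
  shows "continuous (at_right x) k"
proof -
  have "continuous (at_left (- x)) (\<lambda>y. k (- y))"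
    by (rule downward_path_imp_left_continuous[of a b "\<lambda>t. - w t"])
       (use assms in \<open>auto intro: continuous_on_minus\<close>)
  then show ?thesis
    unfolding continuous_within by (simp add: at_right_minus[of x] filterlim_filtermap)
qed

section \<open>Gaussian averages\<close>

text \<open>
  The quotient of the two densities is \<open>exp (- (w - \<mu>)\<^sup>2 / 2 * (1 / t - 1)) / sqrt t\<close>. The point of the
  bound is that for \<open>\<delta> > 0\<close> its factor tends to \<open>0\<close> faster than \<open>t\<close> does.
\<close>
lemma normal_density_tail_le:
  assumes t: "0 < t" "t < 1" and d: "0 \<le> \<delta>" "\<delta> \<le> \<bar>w - \<mu>\<bar>"
  shows "normal_density \<mu> (sqrt t) w
      \<le> exp (- \<delta>\<^sup>2 / 2 * (1 / t - 1)) / sqrt t * normal_density \<mu> 1 w"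
proof -
  have sq: "\<delta>\<^sup>2 \<le> (w - \<mu>)\<^sup>2" using power_mono[OF d(2) d(1), of 2] by simp
  have "normal_density \<mu> (sqrt t) w
      = exp (- (w - \<mu>)\<^sup>2 / 2 * (1 / t - 1)) / sqrt t * normal_density \<mu> 1 w"
    using t by (simp add: normal_density_def real_sqrt_mult field_simps flip: exp_add)
  also have "\<dots> \<le> exp (- \<delta>\<^sup>2 / 2 * (1 / t - 1)) / sqrt t * normal_density \<mu> 1 w"
    using sq t by (intro mult_right_mono divide_right_mono) (auto intro!: mult_right_mono)
  finally show ?thesis .
qed

text \<open>
  Moving the mean costs only a constant factor once the variance is doubled, since
  \<open>w\<^sup>2 \<le> 2 * (w - z)\<^sup>2 + 2 * z\<^sup>2\<close>. The constant is uniform for \<open>z\<close> in a bounded set, which provides a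
  dominating function for means varying in that set.
\<close>
lemma normal_density_shift_le:
  assumes t: "0 < t" and z: "\<bar>z\<bar> \<le> R"
  shows "normal_density z (sqrt t) w
      \<le> sqrt 2 * exp (R\<^sup>2 / (2 * t)) * normal_density 0 (sqrt (2 * t)) w"
proof -
  have "0 \<le> (w - 2 * z)\<^sup>2" by simp
  then have "w\<^sup>2 \<le> 2 * (w - z)\<^sup>2 + 2 * z\<^sup>2" by (simp add: power2_eq_square algebra_simps)
  moreover have "z\<^sup>2 \<le> R\<^sup>2" using power_mono[OF z, of 2] by simp
  ultimately have "w\<^sup>2 \<le> 2 * (w - z)\<^sup>2 + 2 * R\<^sup>2" by linarith
  then have "- (w - z)\<^sup>2 / (2 * t) \<le> R\<^sup>2 / (2 * t) - w\<^sup>2 / (4 * t)"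
    using t by (simp add: field_simps)
  then have "exp (- (w - z)\<^sup>2 / (2 * t)) \<le> exp (R\<^sup>2 / (2 * t)) * exp (- w\<^sup>2 / (4 * t))"
    by (simp flip: exp_add)
  then have "1 / sqrt (2 * pi * t) * exp (- (w - z)\<^sup>2 / (2 * t))
      \<le> 1 / sqrt (2 * pi * t) * (exp (R\<^sup>2 / (2 * t)) * exp (- w\<^sup>2 / (4 * t)))"
    using t by (intro mult_left_mono) auto
  also have "\<dots> = sqrt 2 * exp (R\<^sup>2 / (2 * t)) * normal_density 0 (sqrt (2 * t)) w"
    using t by (simp add: normal_density_def real_sqrt_mult field_simps)
  finally show ?thesis using t by (simp add: normal_density_def)
qed

lemma gaussian_average_shift_integrable:
  fixes k :: "real \<Rightarrow> real"
  assumes t: "0 < t" and [measurable]: "k \<in> borel_measurable borel"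
    and int: "integrable lborel (\<lambda>w. normal_density 0 (sqrt (2 * t)) w * k w)"
  shows "integrable lborel (\<lambda>w. normal_density z (sqrt t) w * k w)"
proof (rule Bochner_Integration.integrable_bound)
  show "integrable lborel (\<lambda>w. sqrt 2 * exp (\<bar>z\<bar>\<^sup>2 / (2 * t)) * (normal_density 0 (sqrt (2 * t)) w * k w))"
    using int by simp
  have "normal_density z (sqrt t) w * \<bar>k w\<bar>
      \<le> (sqrt 2 * exp (\<bar>z\<bar>\<^sup>2 / (2 * t)) * normal_density 0 (sqrt (2 * t)) w) * \<bar>k w\<bar>" for w
    by (intro mult_right_mono normal_density_shift_le t) auto
  then show "AE w in lborel. norm (normal_density z (sqrt t) w * k w) \<le>
      norm (sqrt 2 * exp (\<bar>z\<bar>\<^sup>2 / (2 * t)) * (normal_density 0 (sqrt (2 * t)) w * k w))"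
    by (auto simp: abs_mult mult.assoc)
qed measurable

lemma gaussian_average_continuous:
  fixes k :: "real \<Rightarrow> real"
  assumes t: "0 < t" and [measurable]: "k \<in> borel_measurable borel"
    and int: "integrable lborel (\<lambda>w. normal_density 0 (sqrt (2 * t)) w * k w)"
  shows "continuous_on UNIV (\<lambda>z. \<integral>w. normal_density z (sqrt t) w * k w \<partial>lborel)"
proof -
  have "isCont (\<lambda>z. \<integral>w. normal_density z (sqrt t) w * k w \<partial>lborel) z" for z
    unfolding continuous_at_sequentially comp_def
  proof (intro allI impI)
    fix X assume X: "X \<longlonglongrightarrow> z"
    then obtain R where R: "\<And>n. norm (X n) \<le> R"
      using convergent_imp_Bseq[of X] by (auto simp: convergent_def Bseq_def)
    show "(\<lambda>n. \<integral>w. normal_density (X n) (sqrt t) w * k w \<partial>lborel)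
        \<longlonglongrightarrow> (\<integral>w. normal_density z (sqrt t) w * k w \<partial>lborel)"
    proof (rule integral_dominated_convergence)
      show "integrable lborel (\<lambda>w. sqrt 2 * exp (R\<^sup>2 / (2 * t)) * \<bar>normal_density 0 (sqrt (2 * t)) w * k w\<bar>)"
        using int by simp
      show "AE w in lborel. (\<lambda>n. normal_density (X n) (sqrt t) w * k w)
          \<longlonglongrightarrow> normal_density z (sqrt t) w * k w"
        unfolding normal_density_def using t X by (auto intro!: tendsto_intros)
      show "AE w in lborel. norm (normal_density (X n) (sqrt t) w * k w)
          \<le> sqrt 2 * exp (R\<^sup>2 / (2 * t)) * \<bar>normal_density 0 (sqrt (2 * t)) w * k w\<bar>" for n
      proof (rule AE_I2)
        fix w
        have "normal_density (X n) (sqrt t) w * \<bar>k w\<bar>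
            \<le> (sqrt 2 * exp (R\<^sup>2 / (2 * t)) * normal_density 0 (sqrt (2 * t)) w) * \<bar>k w\<bar>"
          using R[of n] by (intro mult_right_mono normal_density_shift_le t) auto
        then show "norm (normal_density (X n) (sqrt t) w * k w)
            \<le> sqrt 2 * exp (R\<^sup>2 / (2 * t)) * \<bar>normal_density 0 (sqrt (2 * t)) w * k w\<bar>"
          by (simp add: abs_mult mult.assoc)
      qed
    qed measurable
  qed
  then show ?thesis by (simp add: continuous_at_imp_continuous_on)
qed

text \<open>
  If \<open>m\<close> is nonpositive near \<open>\<mu>\<close>, only the tails contribute positively to its average. Thus the
  average of a function near a local maximum exceeds the maximum by very little when the variance is
  small.
\<close>
lemma gaussian_average_le_at_local_max:
  fixes m :: "real \<Rightarrow> real"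
  assumes t: "0 < t" "t < 1" and "0 \<le> \<delta>"
    and int: "integrable lborel (\<lambda>w. normal_density \<mu> 1 w * m w)"
    and m: "\<And>w. \<bar>w - \<mu>\<bar> \<le> \<delta> \<Longrightarrow> m w \<le> 0"
  shows "(\<integral>w. normal_density \<mu> (sqrt t) w * m w \<partial>lborel)
      \<le> exp (- \<delta>\<^sup>2 / 2 * (1 / t - 1)) / sqrt t * (\<integral>w. \<bar>normal_density \<mu> 1 w * m w\<bar> \<partial>lborel)"
proof -
  let ?r = "exp (- \<delta>\<^sup>2 / 2 * (1 / t - 1)) / sqrt t"
  have r: "0 \<le> ?r" using t by simp
  have "(\<integral>w. normal_density \<mu> (sqrt t) w * m w \<partial>lborel)
      \<le> (\<integral>w. ?r * \<bar>normal_density \<mu> 1 w * m w\<bar> \<partial>lborel)"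
  proof (rule integral_mono_AE')
    show "integrable lborel (\<lambda>w. ?r * \<bar>normal_density \<mu> 1 w * m w\<bar>)"
      using int by (intro integrable_mult_right integrable_abs)
    show "AE w in lborel. normal_density \<mu> (sqrt t) w * m w \<le> ?r * \<bar>normal_density \<mu> 1 w * m w\<bar>"
    proof (rule AE_I2)
      fix w
      show "normal_density \<mu> (sqrt t) w * m w \<le> ?r * \<bar>normal_density \<mu> 1 w * m w\<bar>"
      proof (cases "\<bar>w - \<mu>\<bar> \<le> \<delta>")
        case True
        then have "normal_density \<mu> (sqrt t) w * m w \<le> 0"
          using m by (intro mult_nonneg_nonpos) auto
        also have "0 \<le> ?r * \<bar>normal_density \<mu> 1 w * m w\<bar>" using r by (intro mult_nonneg_nonneg) auto
        finally show ?thesis .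
      next
        case False
        have "normal_density \<mu> (sqrt t) w * m w \<le> normal_density \<mu> (sqrt t) w * \<bar>m w\<bar>"
          by (intro mult_left_mono) auto
        also have "\<dots> \<le> (?r * normal_density \<mu> 1 w) * \<bar>m w\<bar>"
          using False assms by (intro mult_right_mono normal_density_tail_le) auto
        finally show ?thesis by (simp add: abs_mult mult.assoc)
      qed
    qed
    show "AE w in lborel. 0 \<le> ?r * \<bar>normal_density \<mu> 1 w * m w\<bar>"
      using r by (intro AE_I2 mult_nonneg_nonneg) auto
  qed
  then show ?thesis by simp
qed

lemma gaussian_quadratic_average:
  assumes s: "0 < \<sigma>"
  shows "has_bochner_integral lborel
      (\<lambda>w. normal_density \<mu> \<sigma> w * (p + q * (w - \<mu>) + e * (w - \<mu>)\<^sup>2)) (p + e * \<sigma>\<^sup>2)"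
proof -
  have "has_bochner_integral lborel (normal_density \<mu> \<sigma>) 1"
    using s by (simp add: has_bochner_integral_iff)
  moreover have "has_bochner_integral lborel (\<lambda>w. normal_density \<mu> \<sigma> w * (w - \<mu>)) 0"
    using normal_moment_odd[OF s, of \<mu> 0] by simp
  moreover have "has_bochner_integral lborel (\<lambda>w. normal_density \<mu> \<sigma> w * (w - \<mu>)\<^sup>2) (\<sigma>\<^sup>2)"
    using normal_moment_even[OF s, of \<mu> 1] by simp
  ultimately have "has_bochner_integral lborel
      (\<lambda>w. p * normal_density \<mu> \<sigma> w + q * (normal_density \<mu> \<sigma> w * (w - \<mu>))
          + e * (normal_density \<mu> \<sigma> w * (w - \<mu>)\<^sup>2)) (p * 1 + q * 0 + e * \<sigma>\<^sup>2)"
    by (intro has_bochner_integral_add has_bochner_integral_mult_right) auto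
  then show ?thesis by (simp add: algebra_simps)
qed

text \<open>
  Maximum principle. If \<open>k\<close> exceeded its chord somewhere, then \<open>k\<close> minus the chord plus a small
  multiple of the convex parabola \<open>(y - a) * (y - b)\<close> would vanish at the end points and have a positive
  interior maximum. Averaging with variance \<open>t\<close> reproduces \<open>k\<close> and the chord and raises the parabola,
  hence the value at the maximum, by exactly \<open>\<epsilon> * t\<close>; but a value at a local maximum can only rise by
  \<open>o(t)\<close>.
\<close>
lemma gaussian_mean_value_imp_below_chord:
  fixes k :: "real \<Rightarrow> real"
  assumes cont: "continuous_on UNIV k"
    and mv: "\<And>t z. 0 < t \<Longrightarrow>
      has_bochner_integral lborel (\<lambda>w. normal_density z (sqrt t) w * k w) (k z)"
    and x: "a < x" "x < b"
  shows "k x \<le> k a + (k b - k a) / (b - a) * (x - a)"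
proof (rule ccontr)
  define l where "l = (k b - k a) / (b - a)"
  assume "\<not> ?thesis"
  then have gap: "k x - k a - l * (x - a) > 0" by (simp add: l_def)
  \<comment> \<open>Half of the largest factor for which the perturbed function is still nonnegative at \<open>x\<close>.\<close>
  define \<epsilon> where "\<epsilon> = (k x - k a - l * (x - a)) / (2 * ((x - a) * (b - x)))"
  have pos: "(x - a) * (b - x) > 0" using x by simp
  have \<epsilon>: "\<epsilon> > 0" using gap pos by (simp add: \<epsilon>_def)
  define q where "q y = \<epsilon> * (y - a) * (y - b) - k a - l * (y - a)" for y
  define v where "v y = k y + q y" for y
  have va: "v a = 0" and vb: "v b = 0" using x by (simp_all add: v_def q_def l_def)
  have "2 * (u / (2 * v) * v) = u" if "0 < v" for u v :: real using that by simp
  from this[OF pos] have "2 * (\<epsilon> * ((x - a) * (b - x))) = k x - k a - l * (x - a)"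
    unfolding \<epsilon>_def .
  then have vx: "v x > 0" using gap by (simp add: v_def q_def algebra_simps)
  have "continuous_on {a..b} v"
    unfolding v_def q_def by (intro continuous_intros continuous_on_subset[OF cont]) auto
  then obtain x0 where x0: "x0 \<in> {a..b}" "\<And>y. y \<in> {a..b} \<Longrightarrow> v y \<le> v x0"
    using continuous_attains_sup[of "{a..b}" v] x by auto
  have "v x0 > 0" using x0(2)[of x] vx x by simp
  then have "x0 \<noteq> a" "x0 \<noteq> b" using va vb by auto
  then have x0': "a < x0" "x0 < b" using x0(1) by auto
  \<comment> \<open>The distance to the end points, within which \<open>v x0\<close> is known to be the maximum.\<close>
  define \<delta> where "\<delta> = min (x0 - a) (b - x0)"
  have \<delta>: "\<delta> > 0" using x0' by (simp add: \<delta>_def)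
  have vint: "has_bochner_integral lborel
      (\<lambda>w. normal_density x0 (sqrt t) w * (v w - v x0)) (\<epsilon> * t)" if t: "t > 0" for t
  proof -
    define q1 where "q1 = \<epsilon> * (2 * x0 - a - b) - l"
    have q_expand: "q w = q x0 + q1 * (w - x0) + \<epsilon> * (w - x0)\<^sup>2" for w
      by (simp add: q_def q1_def power2_eq_square algebra_simps)
    have "v w - v x0 = k w + (- k x0 + q1 * (w - x0) + \<epsilon> * (w - x0)\<^sup>2)" for w
      unfolding v_def using q_expand[of w] by linarith
    moreover have "has_bochner_integral lborel
        (\<lambda>w. normal_density x0 (sqrt t) w * k w
          + normal_density x0 (sqrt t) w * (- k x0 + q1 * (w - x0) + \<epsilon> * (w - x0)\<^sup>2))
        (k x0 + (- k x0 + \<epsilon> * (sqrt t)\<^sup>2))"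
      using t by (intro has_bochner_integral_add mv gaussian_quadratic_average) auto
    ultimately show ?thesis using t by (simp add: distrib_left)
  qed
  define C where "C = (\<integral>w. \<bar>normal_density x0 1 w * (v w - v x0)\<bar> \<partial>lborel)"
  have upper: "\<epsilon> * t \<le> exp (- \<delta>\<^sup>2 / 2 * (1 / t - 1)) / sqrt t * C" if t: "0 < t" "t < 1" for t
  proof -
    have "\<epsilon> * t = (\<integral>w. normal_density x0 (sqrt t) w * (v w - v x0) \<partial>lborel)"
      using vint[OF t(1)] by (simp add: has_bochner_integral_iff)
    also have "\<dots> \<le> exp (- \<delta>\<^sup>2 / 2 * (1 / t - 1)) / sqrt t * C"
      unfolding C_def
    proof (rule gaussian_average_le_at_local_max[OF t])
      show "integrable lborel (\<lambda>w. normal_density x0 1 w * (v w - v x0))"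
        using vint[of 1] by (simp add: has_bochner_integral_iff)
      show "v w - v x0 \<le> 0" if "\<bar>w - x0\<bar> \<le> \<delta>" for w
        using x0(2)[of w] that by (auto simp: \<delta>_def abs_le_iff)
    qed (use \<delta> in simp)
    finally show ?thesis .
  qed
  define c where "c = \<delta>\<^sup>2 / 2"
  have "c > 0" using \<delta> by (simp add: c_def)
  then have "((\<lambda>t. exp (- c * (1 / t - 1)) / sqrt t * C / t) \<longlongrightarrow> 0) (at_right 0)"
    by real_asymp
  then have "eventually (\<lambda>t. exp (- c * (1 / t - 1)) / sqrt t * C / t < \<epsilon>) (at_right 0)"
    using \<epsilon> by (rule order_tendstoD)
  moreover have "eventually (\<lambda>t::real. 0 < t \<and> t < 1) (at_right 0)"
    unfolding eventually_at_right_field by (intro exI[of _ 1]) auto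
  ultimately have "eventually (\<lambda>t. 0 < t \<and> t < 1 \<and> exp (- c * (1 / t - 1)) / sqrt t * C / t < \<epsilon>) (at_right (0::real))"
    by eventually_elim auto
  then obtain t where t: "0 < t" "t < 1" "exp (- c * (1 / t - 1)) / sqrt t * C / t < \<epsilon>"
    using eventually_happens'[OF trivial_limit_at_right_real] by blast
  then have "exp (- c * (1 / t - 1)) / sqrt t * C < \<epsilon> * t"
    by (simp only: pos_divide_less_eq)
  then show False using upper[OF t(1,2)] by (simp add: c_def)
qed

lemma gaussian_mean_value_imp_affine:
  fixes k :: "real \<Rightarrow> real"
  assumes cont: "continuous_on UNIV k"
    and mv: "\<And>t z. 0 < t \<Longrightarrow>
      has_bochner_integral lborel (\<lambda>w. normal_density z (sqrt t) w * k w) (k z)"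
  shows "k x = k 0 + (k 1 - k 0) * x"
proof -
  have chord: "k y = k a + (k b - k a) / (b - a) * (y - a)" if y: "a < y" "y < b" for a b y
  proof (rule antisym)
    show "k y \<le> k a + (k b - k a) / (b - a) * (y - a)"
      using cont mv y by (rule gaussian_mean_value_imp_below_chord)
    have "- k y \<le> - k a + (- k b - - k a) / (b - a) * (y - a)"
    proof (rule gaussian_mean_value_imp_below_chord[OF _ _ y])
      show "continuous_on UNIV (\<lambda>y. - k y)" using cont by (rule continuous_on_minus)
      show "has_bochner_integral lborel (\<lambda>w. normal_density z (sqrt t) w * - k w) (- k z)"
        if "0 < t" for t z
        using has_bochner_integral_minus[OF mv[OF that]] by simp
    qed
    also have "\<dots> = - (k a + (k b - k a) / (b - a) * (y - a))"
      using y by (simp add: field_simps)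
    finally show "k a + (k b - k a) / (b - a) * (y - a) \<le> k y" by simp
  qed
  \<comment> \<open>One chord whose interval contains \<open>0\<close>, \<open>1\<close> and \<open>x\<close>.\<close>
  define N where "N = \<bar>x\<bar> + 2"
  define l where "l = (k N - k (- N)) / (2 * N)"
  have eq: "k y = k (- N) + l * (y + N)" if "- N < y" "y < N" for y
    using chord[OF that] by (simp add: l_def)
  have "k x = k (- N) + l * (x + N)" "k 0 = k (- N) + l * N" "k 1 = k (- N) + l * (1 + N)"
    using eq[of x] eq[of 0] eq[of 1] by (auto simp: N_def)
  then show ?thesis by (simp add: algebra_simps)
qed

lemma continuous_AE_eq_imp_eq:
  fixes u v :: "real \<Rightarrow> real"
  assumes u: "continuous_on UNIV u" and v: "continuous_on UNIV v"
    and eq: "AE x in lborel. u x = v x"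
  shows "u x = v x"
proof (rule ccontr)
  assume "u x \<noteq> v x"
  have op: "open {x. u x \<noteq> v x}" using u v by (rule open_Collect_neq)
  have "{x. u x \<noteq> v x} \<in> null_sets lborel"
    using AE_iff_null[of lborel "\<lambda>x. u x = v x"] op eq by simp
  then have "negligible {x. u x \<noteq> v x}"
    by (simp add: negligible_iff_null_sets null_sets_completionI)
  with op have "{x. u x \<noteq> v x} = {}" using open_not_negligible by blast
  then show False using \<open>u x \<noteq> v x\<close> by auto
qed

section \<open>Functions of Brownian motion that are martingales\<close>

lemma (in prob_space) normal_prob_interval_pos:
  assumes X: "distributed M lborel X (normal_density \<mu> \<sigma>)" and "0 < \<sigma>" "a < b"
  shows "prob {\<omega> \<in> space M. X \<omega> \<in> {a<..<b}} > 0"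
proof (rule ccontr)
  assume "\<not> ?thesis"
  then have "prob (X -` {a<..<b} \<inter> space M) = 0"
    by (simp add: zero_less_measure_iff vimage_def Int_def conj_commute)
  then have "emeasure M (X -` {a<..<b} \<inter> space M) = 0" by (simp add: emeasure_eq_measure)
  then have "(\<integral>\<^sup>+x. ennreal (normal_density \<mu> \<sigma> x) * indicator {a<..<b} x \<partial>lborel) = 0"
    using distributed_emeasure[OF X, of "{a<..<b}"] by simp
  then have "AE x in lborel. ennreal (normal_density \<mu> \<sigma> x) * indicator {a<..<b} x = 0"
    by (subst (asm) nn_integral_0_iff_AE) auto
  then have "AE x in lborel. x \<notin> {a<..<b}"
  proof eventually_elim
    case (elim x)
    then show ?case
      using normal_density_pos[OF \<open>0 < \<sigma>\<close>, of \<mu> x] by (auto split: split_indicator_asm)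
  qed
  then have "emeasure lborel {a<..<b} = 0"
    by (subst (asm) AE_iff_measurable[OF _ refl]) (auto simp: conj_commute greaterThanLessThan_def greaterThan_def lessThan_def Int_def)
  then show False using \<open>a < b\<close> by simp
qed

context brownian_setting
begin

lemma W_measurable: "0 \<le> t \<Longrightarrow> W t \<in> borel_measurable M"
  using W_standard_BM by (simp add: standard_BM_def)

lemma W_zero: "AE \<omega> in M. W 0 \<omega> = 0"
  using W_standard_BM by (simp add: standard_BM_def)

lemma W_continuous_paths: "AE \<omega> in M. continuous_on {0..} (\<lambda>t. W t \<omega>)"
  using W_standard_BM by (simp add: standard_BM_def)

lemma W_increment_normal:
  "0 \<le> s \<Longrightarrow> s < t \<Longrightarrow>
    distributed M lborel (\<lambda>\<omega>. W t \<omega> - W s \<omega>) (normal_density 0 (sqrt (t - s)))"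
  using W_standard_BM by (simp add: standard_BM_def)

lemma subalgebra_F: "0 \<le> t \<Longrightarrow> subalgebra M (F t)"
  using usual_filtration by (simp add: usual_filtration_def)

lemma sigma_finite_subalgebra_F: "0 \<le> t \<Longrightarrow> sigma_finite_subalgebra M (F t)"
  using subalgebra_F finite_measure_axioms
  by (intro finite_measure_subalgebra_is_sigma_finite)
     (simp add: finite_measure_subalgebra_def finite_measure_subalgebra_axioms_def)

lemma W_normal:
  assumes "0 < t"
  shows "distributed M lborel (W t) (normal_density 0 (sqrt t))"
proof -
  have "distr M lborel (W t) = distr M lborel (\<lambda>\<omega>. W t \<omega> - W 0 \<omega>)"
    using W_zero W_measurable[of t] W_measurable[of 0] assms
    by (intro distr_cong_AE) auto
  then show ?thesis
    using W_increment_normal[of 0 t] W_measurable[of t] assms by (simp add: distributed_def)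
qed

text \<open>
  Independence of the increment from the whole past is passed on to every random variable that is
  known at time \<open>s\<close>, in particular to \<open>W s\<close> and to indicators of past events.
\<close>
lemma past_indep_increment:
  assumes st: "0 \<le> s" "s \<le> t" and X: "X \<in> borel_measurable (F s)"
  shows "indep_var borel X borel (\<lambda>\<omega>. W t \<omega> - W s \<omega>)"
proof -
  have sub: "subalgebra M (F s)" using st by (intro subalgebra_F)
  have [measurable]: "X \<in> borel_measurable M" using sub X by (rule measurable_from_subalg)
  have [measurable]: "W t \<in> borel_measurable M" "W s \<in> borel_measurable M"
    using st by (auto intro: W_measurable)
  have preimages_stable: "Int_stable {Y -` A \<inter> space M |A. A \<in> sets borel}" for Y :: "'a \<Rightarrow> real"
  proof (rule Int_stableI, clarify)
    fix A B :: "real set" assume "A \<in> sets borel" "B \<in> sets borel"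
    then show "\<exists>C. Y -` A \<inter> space M \<inter> (Y -` B \<inter> space M) = Y -` C \<inter> space M \<and> C \<in> sets borel"
      by (intro exI[of _ "A \<inter> B"]) auto
  qed
  show ?thesis
    unfolding indep_var_eq
  proof (intro conjI indep_set_sigma_sets indep_setI)
    fix a b
    assume "a \<in> {X -` A \<inter> space M |A. A \<in> sets borel}"
    then have a: "a \<in> sets (F s)"
      using measurable_sets[OF X] sub by (auto simp: subalgebra_def)
    assume "b \<in> {(\<lambda>\<omega>. W t \<omega> - W s \<omega>) -` A \<inter> space M |A. A \<in> sets borel}"
    then have "b \<in> {{\<omega> \<in> space M. W t \<omega> - W s \<omega> \<in> A} | A. A \<in> sets borel}"
      by (auto simp: vimage_def Int_def conj_commute)
    from indep_setD[OF W_increments_indep[OF st] this a]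
    show "prob (a \<inter> b) = prob a * prob b" by (simp add: Int_commute mult.commute)
  next
    show "Int_stable {X -` A \<inter> space M |A. A \<in> sets borel}" by (rule preimages_stable)
    show "Int_stable {(\<lambda>\<omega>. W t \<omega> - W s \<omega>) -` A \<inter> space M |A. A \<in> sets borel}"
      by (rule preimages_stable)
  qed (auto intro: measurable_sets)
qed

lemma W_integrable:
  assumes "0 \<le> t" shows "integrable M (W t)"
proof (cases "t = 0")
  case True
  have "integrable M (W 0) \<longleftrightarrow> integrable M (\<lambda>_. 0 :: real)"
    using W_zero W_measurable[of 0] by (intro integrable_cong_AE) auto
  then show ?thesis using True by simp
next
  case False
  then show ?thesis
    using assms distributed_integrable_var[OF W_normal[of t]] integrable_normal_moment_nz_1[of "sqrt t" 0]
    by simp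
qed

text \<open>
  On a past event the increment integrates to \<open>0\<close>: it is independent of the indicator of the event and
  centred.
\<close>
lemma affine_W_in_rc_martingales: "(\<lambda>t \<omega>. p + q * W t \<omega>) \<in> rc_martingales M F"
proof -
  have ad: "(\<lambda>\<omega>. p + q * W t \<omega>) \<in> borel_measurable (F t)" if "0 \<le> t" for t
  proof -
    have [measurable]: "W t \<in> borel_measurable (F t)" using W_adapted that by (simp add: adapted_def)
    show ?thesis by measurable
  qed
  have int: "integrable M (\<lambda>\<omega>. p + q * W t \<omega>)" if "0 \<le> t" for t
    using W_integrable[OF that] by simp
  have "AE \<omega> in M. real_cond_exp M (F s) (\<lambda>\<omega>. p + q * W t \<omega>) \<omega> = p + q * W s \<omega>"
    if st: "0 \<le> s" "s \<le> t" for s t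
  proof (rule sigma_finite_subalgebra.real_cond_exp_charact[OF sigma_finite_subalgebra_F[OF st(1)]])
    fix A assume A: "A \<in> sets (F s)"
    have AM [measurable]: "A \<in> sets M" using A subalgebra_F[OF st(1)] by (auto simp: subalgebra_def)
    let ?D = "\<lambda>\<omega>. W t \<omega> - W s \<omega>"
    have D: "integrable M ?D" using st W_integrable[of t] W_integrable[of s] by simp
    have "(\<integral>\<omega>. ?D \<omega> \<partial>M) = 0"
    proof (cases "s = t")
      case False
      then show ?thesis
        using st by (intro normal_distributed_expectation[OF _ W_increment_normal]) auto
    qed simp
    moreover have "indep_var borel (indicator A :: 'a \<Rightarrow> real) borel ?D"
      using A by (intro past_indep_increment[OF st]) auto
    then have "(\<integral>\<omega>. indicator A \<omega> * ?D \<omega> \<partial>M) = (\<integral>\<omega>. indicator A \<omega> \<partial>M) * (\<integral>\<omega>. ?D \<omega> \<partial>M)"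
      using D AM by (intro indep_var_lebesgue_integral integrable_real_indicator)
        (auto simp: emeasure_eq_measure)
    ultimately have 0: "(\<integral>\<omega>. indicator A \<omega> * ?D \<omega> \<partial>M) = 0" by simp
    have i: "integrable M (\<lambda>\<omega>. indicator A \<omega> * (p + q * W s \<omega>))" "integrable M (\<lambda>\<omega>. indicator A \<omega> * ?D \<omega>)"
      using integrable_mult_indicator[OF AM int[of s]] integrable_mult_indicator[OF AM D] st by auto
    have "(\<integral>\<omega>. indicator A \<omega> * (p + q * W t \<omega>) \<partial>M)
        = (\<integral>\<omega>. indicator A \<omega> * (p + q * W s \<omega>) + q * (indicator A \<omega> * ?D \<omega>) \<partial>M)"
      by (intro Bochner_Integration.integral_cong) (auto simp: algebra_simps)
    also have "\<dots> = (\<integral>\<omega>. indicator A \<omega> * (p + q * W s \<omega>) \<partial>M)"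
      using i 0 by (subst Bochner_Integration.integral_add) auto
    finally show "(LINT \<omega>:A|M. p + q * W t \<omega>) = (LINT \<omega>:A|M. p + q * W s \<omega>)"
      by (simp add: set_lebesgue_integral_def)
  qed (use st ad int in auto)
  moreover have "AE \<omega> in M. \<forall>t\<ge>0. continuous (at_right t) (\<lambda>u. p + q * W u \<omega>)"
    using W_continuous_paths
  proof eventually_elim
    case (elim \<omega>)
    show ?case
    proof (intro allI impI)
      fix t :: real assume "0 \<le> t"
      then have "continuous (at t within {0..}) (\<lambda>u. p + q * W u \<omega>)"
        using elim by (auto simp: continuous_on_eq_continuous_within intro!: continuous_intros)
      then show "continuous (at_right t) (\<lambda>u. p + q * W u \<omega>)"
        by (rule continuous_within_subset) (use \<open>0 \<le> t\<close> in auto)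
    qed
  qed
  ultimately show ?thesis
    using ad int by (auto simp: rc_martingales_def martingale_def adapted_def)
qed

text \<open>
  \<open>W 1\<close> and \<open>W 2 - W 1\<close> are independent with positive densities, so the prescribed behaviour has
  positive probability and cannot be confined to the exceptional set of an almost sure property.
\<close>
lemma exists_path_through_intervals:
  assumes P: "AE \<omega> in M. P \<omega>" and "a < b" "c < d"
  obtains \<omega> where "P \<omega>" "W 1 \<omega> \<in> {a<..<b}" "W 2 \<omega> - W 1 \<omega> \<in> {c<..<d}"
proof -
  let ?E = "(\<lambda>\<omega>. (W 1 \<omega>, W 2 \<omega> - W 1 \<omega>)) -` ({a<..<b} \<times> {c<..<d}) \<inter> space M"
  have "indep_var borel (W 1) borel (\<lambda>\<omega>. W 2 \<omega> - W 1 \<omega>)"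
    using W_adapted by (intro past_indep_increment) (auto simp: adapted_def)
  then have "prob ?E = prob (W 1 -` {a<..<b} \<inter> space M) * prob ((\<lambda>\<omega>. W 2 \<omega> - W 1 \<omega>) -` {c<..<d} \<inter> space M)"
    by (rule indep_varD) auto
  also have "\<dots> > 0"
    using normal_prob_interval_pos[OF W_normal[of 1], of a b]
      normal_prob_interval_pos[OF W_increment_normal[of 1 2], of c d] assms
    by (simp add: vimage_def Int_def conj_commute)
  finally have "prob ?E > 0" .
  then have "?E \<in> events" by (metis less_irrefl measure_notin_sets)
  then have not_null: "\<not> (AE \<omega> in M. \<omega> \<notin> ?E)" using \<open>prob ?E > 0\<close> prob_eq_0[of ?E] by simp
  have "\<exists>\<omega>. P \<omega> \<and> \<omega> \<in> ?E"
  proof (rule ccontr)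
    assume "\<nexists>\<omega>. P \<omega> \<and> \<omega> \<in> ?E"
    then have "AE \<omega> in M. \<omega> \<notin> ?E" using P by (rule_tac eventually_mono) blast+
    then show False using not_null by simp
  qed
  then show ?thesis using that by blast
qed

text \<open>
  For one-sided continuity at \<open>x\<close> from the left, a path is chosen that crosses \<open>x\<close> downwards between
  the times \<open>1\<close> and \<open>2\<close>; for continuity from the right, one that crosses it upwards.
\<close>
lemma right_continuous_along_W_imp_continuous:
  fixes k :: "real \<Rightarrow> real"
  assumes rc: "AE \<omega> in M. \<forall>t\<ge>0. continuous (at_right t) (\<lambda>u. k (W u \<omega>))"
  shows "continuous_on UNIV k"
proof -
  have good: "AE \<omega> in M. continuous_on {0..} (\<lambda>t. W t \<omega>)
      \<and> (\<forall>t\<ge>0. continuous (at_right t) (\<lambda>u. k (W u \<omega>)))"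
    using W_continuous_paths rc by eventually_elim auto
  have "isCont k x" for x
    unfolding continuous_at_split
  proof
    obtain \<omega> where path: "continuous_on {0..} (\<lambda>t. W t \<omega>)
        \<and> (\<forall>t\<ge>0. continuous (at_right t) (\<lambda>u. k (W u \<omega>)))"
      and ends: "W 1 \<omega> \<in> {x<..<x + 1}" "W 2 \<omega> - W 1 \<omega> \<in> {-2<..< -1}"
      by (rule exists_path_through_intervals[OF good, of x "x + 1" "-2" "-1"]) (simp, simp, blast)
    show "continuous (at_left x) k"
    proof (rule downward_path_imp_left_continuous[of 1 2 "\<lambda>t. W t \<omega>"])
      show "continuous_on {1..2} (\<lambda>t. W t \<omega>)"
        using path by (auto intro: continuous_on_subset)
    qed (use path ends in auto)
    obtain \<omega> where path: "continuous_on {0..} (\<lambda>t. W t \<omega>)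
        \<and> (\<forall>t\<ge>0. continuous (at_right t) (\<lambda>u. k (W u \<omega>)))"
      and ends: "W 1 \<omega> \<in> {x - 1<..<x}" "W 2 \<omega> - W 1 \<omega> \<in> {1<..<2}"
      by (rule exists_path_through_intervals[OF good, of "x - 1" x 1 2]) (simp, simp, blast)
    show "continuous (at_right x) k"
    proof (rule upward_path_imp_right_continuous[of 1 2 "\<lambda>t. W t \<omega>"])
      show "continuous_on {1..2} (\<lambda>t. W t \<omega>)"
        using path by (auto intro: continuous_on_subset)
    qed (use path ends in auto)
  qed
  then show ?thesis by (simp add: continuous_at_imp_continuous_on)
qed

text \<open>
  The law of \<open>W 1\<close> has a positive density and \<open>W (1 + t) - W 1\<close> is independent of it. Integrating the
  martingale property over the events \<open>W 1 \<in> B\<close> therefore compares, by Fubini's theorem, the Gaussian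
  average \<open>Q\<close> of \<open>k\<close> with \<open>k\<close> itself on every Borel set \<open>B\<close>, so that they agree almost everywhere.
  Starting at time \<open>1\<close> instead of \<open>0\<close> is essential: \<open>W 0\<close> would give the value at \<open>z = 0\<close> alone.
\<close>
lemma continuous_martingale_imp_gaussian_mean_value:
  fixes k :: "real \<Rightarrow> real"
  assumes cont: "continuous_on UNIV k" and mart: "martingale M F (\<lambda>t \<omega>. k (W t \<omega>))"
    and t: "0 < t"
  shows "has_bochner_integral lborel (\<lambda>w. normal_density z (sqrt t) w * k w) (k z)"
proof -
  have k_meas [measurable]: "k \<in> borel_measurable borel"
    using cont by (rule borel_measurable_continuous_onI)
  have int0: "integrable lborel (\<lambda>w. normal_density 0 (sqrt u) w * k w)" if "0 < u" for u
    using distributed_integrable[OF W_normal[OF that], of k] mart that by (simp add: martingale_def)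
  have int: "integrable lborel (\<lambda>w. normal_density z (sqrt t) w * k w)" for z
    by (rule gaussian_average_shift_integrable[OF t k_meas int0]) (use t in simp)
  define Q where "Q z = (\<integral>w. normal_density z (sqrt t) w * k w \<partial>lborel)" for z
  have Q_cont: "continuous_on UNIV Q"
    unfolding Q_def by (rule gaussian_average_continuous[OF t k_meas int0]) (use t in simp)
  have Q_shift: "(\<integral>w. normal_density 0 (sqrt t) w * k (z + w) \<partial>lborel) = Q z" for z
    unfolding Q_def
    by (subst lborel_integral_real_affine[where c = 1 and t = z]) (simp_all add: normal_density_def)
  let ?D = "\<lambda>\<omega>. W (1 + t) \<omega> - W 1 \<omega>"
  let ?p = "\<lambda>(z, w). normal_density 0 1 z * normal_density 0 (sqrt t) w"
  have "indep_var borel (W 1) borel ?D"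
    using t W_adapted by (intro past_indep_increment) (auto simp: adapted_def)
  then have "indep_var lborel (W 1) lborel ?D"
    by (simp add: indep_var_eq)
  then have "distributed M (lborel \<Otimes>\<^sub>M lborel) (\<lambda>\<omega>. (W 1 \<omega>, ?D \<omega>))
      (\<lambda>(z, w). ennreal (normal_density 0 (sqrt 1) z) * ennreal (normal_density 0 (sqrt (1 + t - 1)) w))"
    using t by (intro distributed_joint_indep W_normal W_increment_normal)
      (auto intro: lborel.sigma_finite_measure_axioms)
  then have joint: "distributed M (lborel \<Otimes>\<^sub>M lborel) (\<lambda>\<omega>. (W 1 \<omega>, ?D \<omega>)) (\<lambda>x. ennreal (?p x))"
    by (simp add: ennreal_mult' split_def)
  have int_M: "integrable M (\<lambda>\<omega>. k (W u \<omega>))" if "0 \<le> u" for u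
    using mart that by (simp add: martingale_def)
  have fubini: "integrable lborel (\<lambda>z. indicator B z * (normal_density 0 1 z * Q z))
     \<and> (\<integral>z. indicator B z * (normal_density 0 1 z * Q z) \<partial>lborel)
      = (\<integral>\<omega>. indicator B (W 1 \<omega>) * k (W (1 + t) \<omega>) \<partial>M)" if [measurable]: "B \<in> sets borel" for B
  proof -
    \<comment> \<open>The integrand on the right, as a function of \<open>W 1\<close> and of the increment.\<close>
    let ?f = "\<lambda>(z, w). indicator B z * k (z + w)"
    have f_meas: "?f \<in> borel_measurable (lborel \<Otimes>\<^sub>M lborel)" by measurable
    have "integrable M (\<lambda>\<omega>. indicator (W 1 -` B \<inter> space M) \<omega> *\<^sub>R k (W (1 + t) \<omega>))"
      using t W_measurable[of 1] by (intro integrable_mult_indicator int_M) (auto intro: measurable_sets)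
    also have "?this \<longleftrightarrow> integrable M (\<lambda>\<omega>. ?f (W 1 \<omega>, ?D \<omega>))"
      by (intro Bochner_Integration.integrable_cong) (auto split: split_indicator)
    finally have i: "integrable (lborel \<Otimes>\<^sub>M lborel) (\<lambda>x. ?p x * ?f x)"
      using distributed_integrable[OF joint f_meas] by auto
    have eq: "(\<integral>w. ?p (z, w) * ?f (z, w) \<partial>lborel) = indicator B z * (normal_density 0 1 z * Q z)" for z
    proof -
      have "(\<integral>w. ?p (z, w) * ?f (z, w) \<partial>lborel)
          = (\<integral>w. (indicator B z * normal_density 0 1 z) * (normal_density 0 (sqrt t) w * k (z + w)) \<partial>lborel)"
        by (intro Bochner_Integration.integral_cong) (auto simp: mult_ac)
      then show ?thesis by (simp add: Q_shift mult.assoc)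
    qed
    have "(\<integral>\<omega>. indicator B (W 1 \<omega>) * k (W (1 + t) \<omega>) \<partial>M) = (\<integral>\<omega>. ?f (W 1 \<omega>, ?D \<omega>) \<partial>M)"
      by simp
    also have "\<dots> = (\<integral>x. ?p x * ?f x \<partial>(lborel \<Otimes>\<^sub>M lborel))"
      using distributed_integral[OF joint f_meas] by auto
    also have "\<dots> = (\<integral>z. \<integral>w. ?p (z, w) * ?f (z, w) \<partial>lborel \<partial>lborel)"
      using lborel_pair.integral_fst'[OF i] by simp
    finally show ?thesis
      using lborel_pair.integrable_fst'[OF i] unfolding eq by simp
  qed
  have "AE z in lborel. normal_density 0 1 z * Q z = normal_density 0 1 z * k z"
  proof (rule density_unique_real)
    show "integrable lborel (\<lambda>z. normal_density 0 1 z * Q z)" using fubini[of UNIV] by simp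
    show "integrable lborel (\<lambda>z. normal_density 0 1 z * k z)" using int0[of 1] by simp
    fix B assume "B \<in> sets (lborel :: real measure)"
    then have B [measurable]: "B \<in> sets borel" by simp
    let ?A = "W 1 -` B \<inter> space M"
    have A: "?A \<in> sets (F 1)"
      using W_adapted subalgebra_F[of 1] measurable_sets[of "W 1" "F 1" borel B]
      by (auto simp: adapted_def subalgebra_def)
    have W1 [measurable]: "W 1 \<in> borel_measurable M" by (intro W_measurable) simp
    have on_A: "(LINT \<omega>:?A|M. g \<omega>) = (\<integral>\<omega>. indicator B (W 1 \<omega>) * g \<omega> \<partial>M)" for g :: "'a \<Rightarrow> real"
      unfolding set_lebesgue_integral_def
      by (intro Bochner_Integration.integral_cong) (auto split: split_indicator)
    have "(LINT z:B|lborel. normal_density 0 1 z * Q z)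
        = (\<integral>\<omega>. indicator B (W 1 \<omega>) * k (W (1 + t) \<omega>) \<partial>M)"
      using fubini[OF B] by (simp add: set_lebesgue_integral_def)
    also have "\<dots> = (LINT \<omega>:?A|M. real_cond_exp M (F 1) (\<lambda>\<omega>. k (W (1 + t) \<omega>)) \<omega>)"
      unfolding on_A[symmetric]
      using t A by (intro sigma_finite_subalgebra.real_cond_exp_intA sigma_finite_subalgebra_F int_M) auto
    also have "\<dots> = (LINT \<omega>:?A|M. k (W 1 \<omega>))"
      unfolding set_lebesgue_integral_def
    proof (rule integral_cong_AE)
      have "AE \<omega> in M. real_cond_exp M (F 1) (\<lambda>\<omega>. k (W (1 + t) \<omega>)) \<omega> = k (W 1 \<omega>)"
        using mart t by (simp add: martingale_def)
      then show "AE \<omega> in M. indicator ?A \<omega> *\<^sub>R real_cond_exp M (F 1) (\<lambda>\<omega>. k (W (1 + t) \<omega>)) \<omega>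
          = indicator ?A \<omega> *\<^sub>R k (W 1 \<omega>)"
        by eventually_elim simp
    qed measurable
    also have "\<dots> = (\<integral>z. normal_density 0 1 z * (indicator B z * k z) \<partial>lborel)"
      unfolding on_A using distributed_integral[OF W_normal[of 1], of "\<lambda>z. indicator B z * k z"] by simp
    finally show "(LINT z:B|lborel. normal_density 0 1 z * Q z)
        = (LINT z:B|lborel. normal_density 0 1 z * k z)"
      by (simp add: set_lebesgue_integral_def mult_ac)
  qed
  then have "AE z in lborel. Q z = k z"
  proof eventually_elim
    case (elim z)
    then show ?case using normal_density_pos[of 1 0 z] by simp
  qed
  then have "Q z = k z" using Q_cont cont by (intro continuous_AE_eq_imp_eq) auto
  then show ?thesis using int[of z] by (simp add: has_bochner_integral_iff Q_def)
qed

lemma rc_martingale_imp_affine: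
  fixes k :: "real \<Rightarrow> real"
  assumes "(\<lambda>t \<omega>. k (W t \<omega>)) \<in> rc_martingales M F"
  shows "k x = k 0 + (k 1 - k 0) * x"
proof -
  have "continuous_on UNIV k"
    using assms by (intro right_continuous_along_W_imp_continuous) (auto simp: rc_martingales_def)
  then show ?thesis
    using assms
    by (intro gaussian_mean_value_imp_affine continuous_martingale_imp_gaussian_mean_value)
       (auto simp: rc_martingales_def)
qed

end

section \<open>Abel's functional equation\<close>

text \<open>
  The odd function \<open>G u = g u - g 0\<close> is additive on nonnegative numbers, because any \<open>u, v \<ge> 0\<close> can be
  written as \<open>u = (x - y)\<^sup>2 / 4\<close> and \<open>v = x * y\<close>; oddness extends this to all signs.
\<close>
lemma measurable_abel_solution_imp_bilinear_kernel:
  assumes "measurable_abel_solution f h g"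
  shows "abel_kernel f h x y = g 0 + (g 1 - g 0) * (x * y)"
proof -
  have eq: "f (x + y) = h (x - y) + g (x * y)" for x y
    using assms by (simp add: measurable_abel_solution_def)
  define G where "G u = g u - g 0" for u
  have G_sq: "G (z\<^sup>2 / 4) = h z - h 0" "G (- (z\<^sup>2 / 4)) = h 0 - h z" for z
    using eq[of "z / 2" "z / 2"] eq[of "z / 2" "- z / 2"] eq[of z 0] eq[of 0 0]
    by (auto simp: G_def power2_eq_square)
  have nonneg: "\<exists>z. u = z\<^sup>2 / 4" if "0 \<le> u" for u :: real
    using that by (intro exI[of _ "2 * sqrt u"]) (simp add: power_mult_distrib)
  have odd: "G (- u) = - G u" for u
  proof (cases "0 \<le> u")
    case True
    then obtain z where "u = z\<^sup>2 / 4" using nonneg by blast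
    then have "G u = h z - h 0" "G (- u) = h 0 - h z" by (simp_all only: G_sq)
    then show ?thesis by simp
  next
    case False
    then obtain z where "- u = z\<^sup>2 / 4" using nonneg[of "- u"] by auto
    then have "G (- u) = h z - h 0" "G (- (- u)) = h 0 - h z" by (simp_all only: G_sq)
    then show ?thesis by simp
  qed
  have add_nonneg: "G (u + v) = G u + G v" if uv: "0 \<le> u" "0 \<le> v" for u v
  proof -
    \<comment> \<open>Solved from \<open>x + y = 2 * sqrt (u + v)\<close> and \<open>x - y = 2 * sqrt u\<close>.\<close>
    define x where "x = sqrt (u + v) + sqrt u"
    define y where "y = sqrt (u + v) - sqrt u"
    have 1: "x + y = 2 * sqrt (u + v)" "x - y = 2 * sqrt u" by (simp_all add: x_def y_def)
    then have "(x + y)\<^sup>2 / 4 = u + v" "(x - y)\<^sup>2 / 4 = u"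
      using uv by (simp_all add: power_mult_distrib)
    moreover have "x * y = v"
      using uv by (simp add: x_def y_def algebra_simps flip: power2_eq_square)
    moreover have "G ((x + y)\<^sup>2 / 4) = G ((x - y)\<^sup>2 / 4) + G (x * y)"
      using G_sq(1)[of "x + y"] G_sq(1)[of "x - y"] eq[of x y] eq[of "x + y" 0]
      by (simp add: G_def)
    ultimately show ?thesis by (simp only:)
  qed
  have add: "G (u + v) = G u + G v" for u v
  proof -
    consider "0 \<le> u" "0 \<le> v" | "u \<le> 0" "v \<le> 0" | "u \<le> 0" "0 \<le> u + v" | "u \<le> 0" "0 \<le> v" "u + v \<le> 0"
      | "v \<le> 0" "0 \<le> u + v" | "v \<le> 0" "0 \<le> u" "u + v \<le> 0" by linarith
    then show ?thesis
    proof cases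
      case 1 then show ?thesis by (rule add_nonneg)
    next
      case 2 then show ?thesis using add_nonneg[of "- u" "- v"] odd[of "u + v"] odd[of u] odd[of v] by simp
    next
      case 3 then show ?thesis using add_nonneg[of "u + v" "- u"] odd[of u] by simp
    next
      case 4 then show ?thesis using add_nonneg[of "- (u + v)" v] odd[of "u + v"] odd[of u] by simp
    next
      case 5 then show ?thesis using add_nonneg[of "u + v" "- v"] odd[of v] by simp
    next
      case 6 then show ?thesis using add_nonneg[of "- (u + v)" u] odd[of "u + v"] odd[of v] by simp
    qed
  qed
  have "G \<in> borel_measurable lebesgue"
    using assms unfolding G_def by (auto simp: measurable_abel_solution_def)
  then have "G (x * y) = G 1 * (x * y)"
    using add by (intro additive_lebesgue_measurable_imp_linear)
  then show ?thesis using eq[of x y] by (simp add: abel_kernel_def G_def)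
qed

text \<open>
  Putting \<open>y = 0\<close> gives \<open>f = h + c\<close>, and \<open>x = y = z / 2\<close> then gives \<open>h z = h 0 + a * z\<^sup>2 / 4\<close>, from which
  measurability is evident.
\<close>
lemma bilinear_kernel_imp_measurable_abel_solution:
  assumes K: "\<And>x y. abel_kernel f h x y = c + a * (x * y)"
  shows "measurable_abel_solution f h (\<lambda>u. c + a * u)"
proof -
  have h: "h = (\<lambda>z. h 0 + a * z\<^sup>2 / 4)"
  proof
    fix z
    show "h z = h 0 + a * z\<^sup>2 / 4"
      using K[of z 0] K[of "z / 2" "z / 2"] by (simp add: abel_kernel_def power2_eq_square)
  qed
  have f: "f = (\<lambda>z. h 0 + a * z\<^sup>2 / 4 + c)"
  proof
    fix z
    show "f z = h 0 + a * z\<^sup>2 / 4 + c"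
      using K[of z 0] fun_cong[OF h, of z] by (simp add: abel_kernel_def)
  qed
  have cont_meas: "u \<in> borel_measurable lebesgue" if "continuous_on UNIV u" for u :: "real \<Rightarrow> real"
    using borel_measurable_continuous_onI[OF that] by (simp add: measurable_completion)
  have "f \<in> borel_measurable lebesgue"
    by (subst f, rule cont_meas) (intro continuous_intros, auto)
  moreover have "h \<in> borel_measurable lebesgue"
    by (subst h, rule cont_meas) (intro continuous_intros, auto)
  moreover have "(\<lambda>u. c + a * u) \<in> borel_measurable lebesgue"
    by (rule cont_meas) (intro continuous_intros)
  ultimately show ?thesis
    using K by (simp add: measurable_abel_solution_def abel_kernel_def algebra_simps)
qed

theorem theorem4p1:
  fixes M :: "'a measure"
    and F :: "real \<Rightarrow> 'a measure"
    and W :: "real \<Rightarrow> 'a \<Rightarrow> real"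
    and f h :: "real \<Rightarrow> real"
  assumes "brownian_setting M F W"
  shows "(\<exists>g. measurable_abel_solution f h g) \<longleftrightarrow>
      (\<forall>y. (\<lambda>t \<omega>. abel_kernel f h (W t \<omega>) y) \<in> rc_martingales M F) \<and>
      (\<forall>x. (\<lambda>t \<omega>. abel_kernel f h x (W t \<omega>)) \<in> rc_martingales M F) \<and>
      (\<exists>c. \<forall>x y. abel_kernel f h 0 y = c \<and> abel_kernel f h x 0 = c)"
    (is "?solvable \<longleftrightarrow> ?first \<and> ?second \<and> ?axes")
proof -
  interpret brownian_setting M F W by (rule assms)
  show ?thesis
  proof
    assume ?solvable
    then obtain g where g: "measurable_abel_solution f h g" by auto
    define a where "a = g 1 - g 0"
    have K: "abel_kernel f h x y = g 0 + a * (x * y)" for x y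
      unfolding a_def using g by (rule measurable_abel_solution_imp_bilinear_kernel)
    have "(\<lambda>t \<omega>. abel_kernel f h (W t \<omega>) y) \<in> rc_martingales M F" for y
      using affine_W_in_rc_martingales[of "g 0" "a * y"] by (simp add: K mult_ac)
    moreover have "(\<lambda>t \<omega>. abel_kernel f h x (W t \<omega>)) \<in> rc_martingales M F" for x
      using affine_W_in_rc_martingales[of "g 0" "a * x"] by (simp add: K mult_ac)
    ultimately show "?first \<and> ?second \<and> ?axes" by (auto simp: K)
  next
    assume *: "?first \<and> ?second \<and> ?axes"
    then obtain c where c: "\<And>y. abel_kernel f h 0 y = c" "\<And>x. abel_kernel f h x 0 = c" by auto
    \<comment> \<open>The constant term is the value on the axis; comparing both expressions at \<open>x = 1\<close> determines the
      slope.\<close>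
    have affine1: "abel_kernel f h x y = c + (abel_kernel f h 1 y - c) * x" for x y
      using rc_martingale_imp_affine[of "\<lambda>x. abel_kernel f h x y" x] * c by simp
    have affine2: "abel_kernel f h x y = c + (abel_kernel f h x 1 - c) * y" for x y
      using rc_martingale_imp_affine[of "\<lambda>y. abel_kernel f h x y" y] * c by simp
    have "abel_kernel f h x y = c + (abel_kernel f h 1 1 - c) * (x * y)" for x y
      using affine1[of x y] affine2[of 1 y] by simp
    then have "measurable_abel_solution f h (\<lambda>u. c + (abel_kernel f h 1 1 - c) * u)"
      by (rule bilinear_kernel_imp_measurable_abel_solution)
    then show ?solvable by auto
  qed
qed

end
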